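(* Let $\mathsf{stat}_1,\ldots,\mathsf{stat}_r$ be nonnegative-integer-valued statistics on partial permutations, let $\mathbf{z}^{\mathbf{stat}(\pi)}:=z_1^{\mathsf{stat}_1(\pi)}\cdots z_r^{\mathsf{stat}_r(\pi)}$, and suppose that the entries $a_{n,k}$ of the Catalan matrix $A^{\mathbf{s},\mathbf{t}}$ with seeds $\mathbf{s}=(s_0,s_1,\ldots)$ and $\mathbf{t}=(t_1,t_2,\ldots)$ satisfy $$a_{n,k}=\sum_{\pi\in\mathfrak{P}_{n,k}}\mathbf{z}^{\mathbf{stat}(\pi)}\qquad(n,k\ge0).$$ Suppose further that the following hold for all $n\ge1$, $k\ge0$: 1. for any $\rho\in\mathfrak{P}_{n-1,k-1}$, $\displaystyle\sum_{\pi\in\mathfrak{P}^{(1)}_{n,k},\,\pi'=\rho}\mathbf{z}^{\mathbf{stat}(\pi)}=\mathbf{z}^{\mathbf{stat}(\rho)}$; 2. for any $\rho\in\mathfrak{P}_{n-1,k}$, $\displaystyle\sum_{\pi\in\mathfrak{P}^{(2)}_{n,k}\cup\mathfrak{P}^{(3)}_{n,k},\,\pi'=\rho}\mathbf{z}^{\mathbf{stat}(\pi)}=s_k\mathbf{z}^{\mathbf{stat}(\rho)}$; 3. for any $\rho\in\mathfrak{P}_{n-1,k+1}$, $\displaystyle\sum_{\pi\in\mathfrak{P}^{(4)}_{n,k},\,\pi'=\rho}\mathbf{z}^{\mathbf{stat}(\pi)}=t_{k+1}\mathbf{z}^{\mathbf{stat}(\rho)}$. Let $\mathbf{s}^+=(s_1,s_2,\ldots)$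 and $\mathbf{t}^+=(t_2,t_3,\ldots)$, and let $A^{\mathbf{s}^+,\mathbf{t}^+}$ be the Catalan matrix generated by them. Then for all $n,k\ge0$ $$\left[A^{\mathbf{s}^+,\mathbf{t}^+}\right]_{n,k}=C_{n+1,k+1}(\mathbf{z}),$$ and for all $n\ge2$ $$C_{n,0}(\mathbf{z})=t_1C_{n-1,1}(\mathbf{z}).$$
   Context: Catalan matrix: given seeds $\mathbf{s}=(s_0,s_1,\ldots)$ and $\mathbf{t}=(t_1,t_2,\ldots)$ with all $t_i\ne0$, $A^{\mathbf{s},\mathbf{t}}=(a_{n,k})_{n,k\ge0}$ is defined by $a_{0,0}=1$, $a_{0,k}=0$ for $k>0$, and $a_{n,k}=a_{n-1,k-1}+s_ka_{n-1,k}+t_{k+1}a_{n-1,k+1}$ for $n\ge1$, with $a_{n,-1}=0$. (For $A^{\mathbf{s}^+,\mathbf{t}^+}$ the seeds are $s^+_\ell=s_{\ell+1}$ for $\ell\ge0$ and $t^+_\ell=t_{\ell+1}$ for $\ell\ge1$.) Seeds take values in a commutative ring containing the variables $z_1,\ldots,z_r$. A partial permutation of order $n$ is an $n\times n$ $(0,1)$-matrix $\pi=(\pi_{i,j})$ with at most one $1$ in each row and each column; $\mathfrak{P}_{n,k}$ is the set of those with exactly $k$ zero rows (for $n=0$ there is only the empty matrix, lying in $\mathfrak{P}_{0,0}$; $\mathfrak{P}_{n,-1}=\emptyset$). For $n\ge1$, $\mathfrak{P}_{n,k}$ is the disjoint union of: $\mathfrak{P}^{(1)}_{n,k}$, those $\pi$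 whose last row and last column are both zero; $\mathfrak{P}^{(2)}_{n,k}$, those with $\pi_{n,n}=1$; $\mathfrak{P}^{(3)}_{n,k}$, those with $\pi_{n,n}=0$ and exactly one of the last row and the last column zero; $\mathfrak{P}^{(4)}_{n,k}$, those with $\pi_{n,n}=0$ and neither the last row nor the last column zero. For $\pi$ of order $n\ge1$, $\pi'$ is the partial permutation of order $n-1$ obtained by deleting the last row and column. A partial permutation $\pi\in\mathfrak{P}_{n,k}$ is connected if there is no $1\le i<n$ such that the principal submatrix formed by the first $i$ rows and columns is a permutation matrix. $\mathfrak{C}_{n,k}$ is the set of connected elements of $\mathfrak{P}_{n,k}$, and $C_{n,k}(\mathbf{z})=\sum_{\pi\in\mathfrak{C}_{n,k}}\mathbf{z}^{\mathbf{stat}(\pi)}$. *)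

theory Defs
  imports "Jordan_Normal_Form.Determinant" "Jordan_Normal_Form.DL_Submatrix"
begin

text \<open>The first seed sequence is indexed from 0, the second from 1: the value \<open>t 0\<close> never occurs.\<close>

fun catalan_matrix :: "(nat \<Rightarrow> 'a::comm_ring_1) \<Rightarrow> (nat \<Rightarrow> 'a) \<Rightarrow> nat \<Rightarrow> nat \<Rightarrow> 'a" where
  "catalan_matrix s t 0 k = (if k = 0 then 1 else 0)"
| "catalan_matrix s t (Suc n) k =
     (if k = 0 then 0 else catalan_matrix s t n (k - 1))
     + s k * catalan_matrix s t n k
     + t (k + 1) * catalan_matrix s t n (k + 1)"

text \<open>Rows and columns are numbered from 0, so the last row and column of a matrix of order
  \<open>n \<ge> 1\<close> have index \<open>n - 1\<close>.\<close>

definition partial_permutation :: "nat \<Rightarrow> nat mat \<Rightarrow> bool" where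
  "partial_permutation n A \<longleftrightarrow>
     A \<in> carrier_mat n n \<and>
     (\<forall>i<n. \<forall>j<n. A $$ (i, j) \<in> {0, 1}) \<and>
     (\<forall>i<n. \<exists>\<^sub>\<le>\<^sub>1j. j < n \<and> A $$ (i, j) = 1) \<and>
     (\<forall>j<n. \<exists>\<^sub>\<le>\<^sub>1i. i < n \<and> A $$ (i, j) = 1)"

definition permutation_matrix :: "nat \<Rightarrow> nat mat \<Rightarrow> bool" where
  "permutation_matrix n A \<longleftrightarrow>
     A \<in> carrier_mat n n \<and>
     (\<forall>i<n. \<forall>j<n. A $$ (i, j) \<in> {0, 1}) \<and>
     (\<forall>i<n. \<exists>!j. j < n \<and> A $$ (i, j) = 1) \<and>
     (\<forall>j<n. \<exists>!i. i < n \<and> A $$ (i, j) = 1)"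

definition partial_perms :: "nat \<Rightarrow> nat \<Rightarrow> nat mat set" where
  "partial_perms n k =
     {A. partial_permutation n A \<and> card {i. i < n \<and> row A i = 0\<^sub>v n} = k}"

definition last_row_zero :: "nat \<Rightarrow> nat mat \<Rightarrow> bool" where
  "last_row_zero n A \<longleftrightarrow> row A (n - 1) = 0\<^sub>v n"

definition last_col_zero :: "nat \<Rightarrow> nat mat \<Rightarrow> bool" where
  "last_col_zero n A \<longleftrightarrow> col A (n - 1) = 0\<^sub>v n"

text \<open>The following four sets, and the deletion of the last row and column, are meant for
  \<open>n \<ge> 1\<close> only.\<close>

definition partial_perms1 :: "nat \<Rightarrow> nat \<Rightarrow> nat mat set" where
  "partial_perms1 n k = {A \<in> partial_perms n k. last_row_zero n A \<and> last_col_zero n A}"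

definition partial_perms2 :: "nat \<Rightarrow> nat \<Rightarrow> nat mat set" where
  "partial_perms2 n k = {A \<in> partial_perms n k. A $$ (n - 1, n - 1) = 1}"

definition partial_perms3 :: "nat \<Rightarrow> nat \<Rightarrow> nat mat set" where
  "partial_perms3 n k =
     {A \<in> partial_perms n k. A $$ (n - 1, n - 1) = 0 \<and> last_row_zero n A \<noteq> last_col_zero n A}"

definition partial_perms4 :: "nat \<Rightarrow> nat \<Rightarrow> nat mat set" where
  "partial_perms4 n k =
     {A \<in> partial_perms n k. A $$ (n - 1, n - 1) = 0 \<and> \<not> last_row_zero n A \<and> \<not> last_col_zero n A}"

definition delete_last :: "nat \<Rightarrow> nat mat \<Rightarrow> nat mat" where
  "delete_last n A = mat_delete A (n - 1) (n - 1)"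

definition connected_pp :: "nat \<Rightarrow> nat mat \<Rightarrow> bool" where
  "connected_pp n A \<longleftrightarrow>
     \<not> (\<exists>i. 1 \<le> i \<and> i < n \<and> permutation_matrix i (submatrix A {..<i} {..<i}))"

definition connected_partial_perms :: "nat \<Rightarrow> nat \<Rightarrow> nat mat set" where
  "connected_partial_perms n k = {A \<in> partial_perms n k. connected_pp n A}"

definition stat_weight ::
  "nat \<Rightarrow> (nat \<Rightarrow> 'a::comm_ring_1) \<Rightarrow> (nat \<Rightarrow> nat mat \<Rightarrow> nat) \<Rightarrow> nat mat \<Rightarrow> 'a" where
  "stat_weight r z stat A = (\<Prod>i=1..r. z i ^ stat i A)"

definition connected_gf ::
  "nat \<Rightarrow> (nat \<Rightarrow> 'a::comm_ring_1) \<Rightarrow> (nat \<Rightarrow> nat mat \<Rightarrow> nat) \<Rightarrow> nat \<Rightarrow> nat \<Rightarrow> 'a" where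
  "connected_gf r z stat n k = (\<Sum>A\<in>connected_partial_perms n k. stat_weight r z stat A)"

text \<open>All sums over partial permutations are finite sums (an infinite one would silently be 0).\<close>

lemma finite_partial_perms: "finite (partial_perms n k)"
proof (rule finite_subset)
  let ?I = "{..<n} \<times> {..<n}"
  let ?F = "PiE ?I (\<lambda>_. {0, 1 :: nat})"
  show "partial_perms n k \<subseteq> (\<lambda>f. mat n n f) ` ?F"
  proof
    fix A assume A: "A \<in> partial_perms n k"
    have "A = mat n n (restrict (\<lambda>p. A $$ p) ?I)"
      using A by (intro eq_matI) (auto simp: partial_perms_def partial_permutation_def)
    moreover have "restrict (\<lambda>p. A $$ p) ?I \<in> ?F"
    proof (subst restrict_PiE_iff, rule ballI)
      fix p assume "p \<in> ?I"
      then obtain i j where "p = (i, j)" "i < n" "j < n" by auto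
      then show "A $$ p \<in> {0, 1}"
        using A by (simp add: partial_perms_def partial_permutation_def)
    qed
    ultimately show "A \<in> (\<lambda>f. mat n n f) ` ?F" by blast
  qed
  show "finite ((\<lambda>f. mat n n f) ` ?F)"
    by (intro finite_imageI finite_PiE) auto
qed

end

theory Submission
  imports Defs
begin

text \<open>A partial permutation of order \<open>n + 1 \<ge> 2\<close> is connected iff deleting its last row and column
  leaves a connected partial permutation that is not a permutation matrix, i.e. has a zero row.
  Summing the three fibre conditions over these, the generating functions \<open>C n k\<close> with \<open>k \<ge> 1\<close>
  satisfy the recurrence of the original Catalan matrix with the term \<open>C n 0\<close> removed, which is the
  recurrence for the shifted seeds.\<close>

section \<open>Zero rows and columns, leading blocks, and deletion of the last row and
  column\<close>

lemma row_eq_zero_iff: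
  assumes "A \<in> carrier_mat n m" "i < n"
  shows "row A i = 0\<^sub>v m \<longleftrightarrow> (\<forall>j<m. A $$ (i, j) = 0)"
  using assms by (auto simp: vec_eq_iff)

lemma col_eq_zero_iff:
  assumes "A \<in> carrier_mat n m" "j < m"
  shows "col A j = 0\<^sub>v n \<longleftrightarrow> (\<forall>i<n. A $$ (i, j) = 0)"
  using assms by (auto simp: vec_eq_iff)

text \<open>An initial segment of the naturals is its own increasing enumeration, so a submatrix on
  such index sets is a leading block without any relabelling.\<close>

lemma pick_lessThan: "a < i \<Longrightarrow> pick {..<i} a = a"
proof (induction a)
  case 0
  then show ?case by (auto intro: Least_equality)
next
  case (Suc a)
  then show ?case by (auto intro!: Least_equality)
qed

lemma submatrix_lessThan:
  assumes "A \<in> carrier_mat n m" "i \<le> n" "j \<le> m"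
  shows "submatrix A {..<i} {..<j} = mat i j (\<lambda>p. A $$ p)"
proof -
  have "{a. a < dim_row A \<and> a \<in> {..<i}} = {..<i}" "{b. b < dim_col A \<and> b \<in> {..<j}} = {..<j}"
    using assms by auto
  then show ?thesis
    unfolding submatrix_def by (intro eq_matI) (auto simp: pick_lessThan)
qed

lemma delete_last_eq:
  assumes "A \<in> carrier_mat (Suc n) (Suc n)"
  shows "delete_last (Suc n) A = mat n n (\<lambda>p. A $$ p)"
  using assms by (intro eq_matI) (auto simp: delete_last_def mat_delete_def)

lemma
  assumes "partial_permutation n A"
  shows partial_permutation_carrier: "A \<in> carrier_mat n n"
    and partial_permutation_entry: "\<lbrakk>i < n; j < n\<rbrakk> \<Longrightarrow> A $$ (i, j) = 0 \<or> A $$ (i, j) = 1"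
    and partial_permutation_row:
      "\<lbrakk>i < n; j < n; j' < n; A $$ (i, j) = 1; A $$ (i, j') = 1\<rbrakk> \<Longrightarrow> j = j'"
    and partial_permutation_col:
      "\<lbrakk>i < n; i' < n; j < n; A $$ (i, j) = 1; A $$ (i', j) = 1\<rbrakk> \<Longrightarrow> i = i'"
proof -
  show "A \<in> carrier_mat n n"
    using assms by (simp add: partial_permutation_def)
  show "A $$ (i, j) = 0 \<or> A $$ (i, j) = 1" if "i < n" "j < n"
    using assms that by (simp add: partial_permutation_def)
  show "j = j'" if "i < n" "j < n" "j' < n" "A $$ (i, j) = 1" "A $$ (i, j') = 1"
  proof (rule Uniq_D)
    show "\<exists>\<^sub>\<le>\<^sub>1j. j < n \<and> A $$ (i, j) = 1"
      using assms that(1) by (simp only: partial_permutation_def)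
  qed (use that in blast)+
  show "i = i'" if "i < n" "i' < n" "j < n" "A $$ (i, j) = 1" "A $$ (i', j) = 1"
  proof (rule Uniq_D)
    show "\<exists>\<^sub>\<le>\<^sub>1i. i < n \<and> A $$ (i, j) = 1"
      using assms that(3) by (simp only: partial_permutation_def)
  qed (use that in blast)+
qed

lemma partial_permutation_delete_last:
  assumes "partial_permutation (Suc n) A"
  shows "partial_permutation n (delete_last (Suc n) A)"
proof -
  have A: "A \<in> carrier_mat (Suc n) (Suc n)"
    using assms by (rule partial_permutation_carrier)
  have entry: "delete_last (Suc n) A $$ (i, j) = A $$ (i, j)" if "i < n" "j < n" for i j
    using that by (simp add: delete_last_eq[OF A])
  show ?thesis
    unfolding partial_permutation_def
  proof (intro conjI allI impI)
    show "delete_last (Suc n) A \<in> carrier_mat n n"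
      by (simp add: delete_last_eq[OF A])
    show "delete_last (Suc n) A $$ (i, j) \<in> {0, 1}" if "i < n" "j < n" for i j
      using partial_permutation_entry[OF assms, of i j] that by (simp add: entry)
    show "\<exists>\<^sub>\<le>\<^sub>1j. j < n \<and> delete_last (Suc n) A $$ (i, j) = 1" if "i < n" for i
    proof (rule Uniq_I)
      show "j = j'" if "j < n \<and> delete_last (Suc n) A $$ (i, j) = 1"
        "j' < n \<and> delete_last (Suc n) A $$ (i, j') = 1" for j j'
        using partial_permutation_row[OF assms, of i j j'] that \<open>i < n\<close> by (auto simp: entry)
    qed
    show "\<exists>\<^sub>\<le>\<^sub>1i. i < n \<and> delete_last (Suc n) A $$ (i, j) = 1" if "j < n" for j
    proof (rule Uniq_I)
      show "i = i'" if "i < n \<and> delete_last (Suc n) A $$ (i, j) = 1"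
        "i' < n \<and> delete_last (Suc n) A $$ (i', j) = 1" for i i'
        using partial_permutation_col[OF assms, of i i' j] that \<open>j < n\<close> by (auto simp: entry)
    qed
  qed
qed

section \<open>Permutation matrices as partial permutations without zero rows\<close>

lemma permutation_matrix_iff_exists:
  "permutation_matrix n A \<longleftrightarrow> partial_permutation n A \<and>
     (\<forall>i<n. \<exists>j<n. A $$ (i, j) = 1) \<and> (\<forall>j<n. \<exists>i<n. A $$ (i, j) = 1)"
  unfolding permutation_matrix_def partial_permutation_def ex1_iff_ex_Uniq by iprover

text \<open>If no row is zero, let \<open>f i\<close> be the column of the one in row
  \<open>i\<close>. No column holds two ones, so \<open>f\<close> is injective on a finite set
  mapped into itself, hence surjective, and every column holds a one as well.\<close>

lemma permutation_matrix_iff: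
  "permutation_matrix n A \<longleftrightarrow> A \<in> partial_perms n 0"
proof
  assume A: "permutation_matrix n A"
  then have pp: "partial_permutation n A" and ex: "\<And>i. i < n \<Longrightarrow> \<exists>j<n. A $$ (i, j) = 1"
    by (simp_all only: permutation_matrix_iff_exists)
  have c: "A \<in> carrier_mat n n"
    using pp by (rule partial_permutation_carrier)
  have "row A i \<noteq> 0\<^sub>v n" if "i < n" for i
    using ex[OF that] row_eq_zero_iff[OF c that] by auto
  with pp show "A \<in> partial_perms n 0"
    by (auto simp: partial_perms_def)
next
  assume "A \<in> partial_perms n 0"
  then have pp: "partial_permutation n A" and nz: "\<And>i. i < n \<Longrightarrow> row A i \<noteq> 0\<^sub>v n"
    by (auto simp: partial_perms_def)
  note c = partial_permutation_carrier[OF pp]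
    and bin = partial_permutation_entry[OF pp]
    and col = partial_permutation_col[OF pp]
  have ex: "\<exists>j<n. A $$ (i, j) = 1" if "i < n" for i
    using nz[OF that] row_eq_zero_iff[OF c that] bin[OF that] by blast
  then obtain f where f: "\<And>i. i < n \<Longrightarrow> f i < n \<and> A $$ (i, f i) = 1"
    by metis
  have "inj_on f {..<n}"
    by (rule inj_onI) (metis f col lessThan_iff)
  then have "f ` {..<n} = {..<n}"
    using f by (intro endo_inj_surj) auto
  then have "\<exists>i<n. A $$ (i, j) = 1" if "j < n" for j
    using that f by (metis imageE lessThan_iff)
  with pp ex show "permutation_matrix n A"
    by (simp only: permutation_matrix_iff_exists) blast
qed

section \<open>Change of the number of zero rows under deletion, and the four classes\<close>

text \<open>Deletion loses the last row, which was counted if it is zero, and turns a row above it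
  into a zero row exactly when that row has its one in the last column. Each correction is added on
  the side where it is missing, so that no truncated subtraction occurs.\<close>

lemma card_zero_rows_delete_last:
  assumes "partial_permutation (Suc n) A"
  shows "card {i. i < n \<and> row (delete_last (Suc n) A) i = 0\<^sub>v n} + (if last_row_zero (Suc n) A then 1 else 0)
       = card {i. i < Suc n \<and> row A i = 0\<^sub>v (Suc n)}
         + (if last_col_zero (Suc n) A \<or> A $$ (n, n) = 1 then 0 else 1)"
proof -
  note c = partial_permutation_carrier[OF assms]
    and bin = partial_permutation_entry[OF assms]
    and row = partial_permutation_row[OF assms]
    and col = partial_permutation_col[OF assms]
  \<comment> \<open>\<open>Z\<close> collects the zero rows of \<open>A\<close> above the last one,
    \<open>E\<close> the rows above the last one that become zero because their only one is deleted
    with the last column.\<close>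
  define Z where "Z = {i. i < n \<and> row A i = 0\<^sub>v (Suc n)}"
  define E where "E = {i. i < n \<and> A $$ (i, n) = 1}"
  have r: "row A i = 0\<^sub>v (Suc n) \<longleftrightarrow> (\<forall>j<Suc n. A $$ (i, j) = 0)" if "i < Suc n" for i
    using row_eq_zero_iff[OF c that] .
  have D: "delete_last (Suc n) A \<in> carrier_mat n n"
    by (simp add: delete_last_eq[OF c])
  have rD: "row (delete_last (Suc n) A) i = 0\<^sub>v n \<longleftrightarrow> (\<forall>j<n. A $$ (i, j) = 0)" if "i < n" for i
    unfolding row_eq_zero_iff[OF D that] using that by (simp add: delete_last_eq[OF c])
  have "{i. i < n \<and> row (delete_last (Suc n) A) i = 0\<^sub>v n} = {i. i < n \<and> (\<forall>j<n. A $$ (i, j) = 0)}"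
    using rD by auto
  also have "\<dots> = Z \<union> E"
  proof (intro equalityI subsetI)
    fix i assume "i \<in> {i. i < n \<and> (\<forall>j<n. A $$ (i, j) = 0)}"
    then show "i \<in> Z \<union> E"
      using bin[of i n] r[of i] by (auto simp: Z_def E_def less_Suc_eq)
  next
    fix i assume i: "i \<in> Z \<union> E"
    then have "i < n" by (auto simp: Z_def E_def)
    moreover have "A $$ (i, j) = 0" if "j < n" for j
      using i \<open>i < n\<close> that bin[of i j] row[of i j n] r[of i] by (auto simp: Z_def E_def)
    ultimately show "i \<in> {i. i < n \<and> (\<forall>j<n. A $$ (i, j) = 0)}" by blast
  qed
  also have "card \<dots> = card Z + card E"
    by (rule card_Un_disjoint) (auto simp: Z_def E_def r)
  finally have del: "card {i. i < n \<and> row (delete_last (Suc n) A) i = 0\<^sub>v n} = card Z + card E" .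
  have "{i. i < Suc n \<and> row A i = 0\<^sub>v (Suc n)} = (if last_row_zero (Suc n) A then insert n Z else Z)"
    by (auto simp: Z_def last_row_zero_def less_Suc_eq)
  then have full: "card {i. i < Suc n \<and> row A i = 0\<^sub>v (Suc n)}
      = card Z + (if last_row_zero (Suc n) A then 1 else 0)"
    by (simp add: Z_def)
  have lc: "last_col_zero (Suc n) A \<longleftrightarrow> (\<forall>i<Suc n. A $$ (i, n) = 0)"
    using col_eq_zero_iff[OF c, of n] by (simp add: last_col_zero_def)
  \<comment> \<open>A column holds at most one 1, so \<open>E\<close> has at most one element. It is
    empty if the last column is zero or has its one in the corner, which lies outside the range of
    \<open>E\<close>.\<close>
  have "card E = (if last_col_zero (Suc n) A \<or> A $$ (n, n) = 1 then 0 else 1)"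
  proof (cases "last_col_zero (Suc n) A \<or> A $$ (n, n) = 1")
    case True
    have "i \<notin> E" for i
      using True lc col[of i n n] by (auto simp: E_def)
    then have "E = {}" by blast
    with True show ?thesis by simp
  next
    case False
    then obtain i where i: "i < Suc n" "A $$ (i, n) \<noteq> 0"
      using lc by blast
    then have i1: "A $$ (i, n) = 1"
      using bin[of i n] by simp
    with False i have "i < n"
      by (auto simp: less_Suc_eq)
    have "j \<in> E \<longleftrightarrow> j = i" for j
      using i1 \<open>i < n\<close> col[of j i n] by (auto simp: E_def)
    then have "E = {i}" by blast
    with False show ?thesis by simp
  qed
  with del full show ?thesis by simp
qed

text \<open>The two corrections in the count of zero rows give a shift of -1 in the first class, 0
  in the second and third, where they are both absent or cancel, and +1 in the fourth. Disjointness
  from the second class holds because a one in the corner makes the last row nonzero.\<close>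

lemma
  assumes "A \<in> partial_perms (Suc n) k"
  shows delete_last_partial_perms1:
      "A \<in> partial_perms1 (Suc n) k \<Longrightarrow> 1 \<le> k \<and> delete_last (Suc n) A \<in> partial_perms n (k - 1)"
    and delete_last_partial_perms23:
      "A \<in> partial_perms2 (Suc n) k \<union> partial_perms3 (Suc n) k \<Longrightarrow> delete_last (Suc n) A \<in> partial_perms n k"
    and delete_last_partial_perms4:
      "A \<in> partial_perms4 (Suc n) k \<Longrightarrow> delete_last (Suc n) A \<in> partial_perms n (k + 1)"
    and partial_perms_cases:
      "A \<in> partial_perms1 (Suc n) k \<or> A \<in> partial_perms2 (Suc n) k \<union> partial_perms3 (Suc n) k
         \<or> A \<in> partial_perms4 (Suc n) k"
    and partial_perms_disjoint:
      "A \<in> partial_perms1 (Suc n) k \<Longrightarrow> A \<notin> partial_perms2 (Suc n) k \<union> partial_perms3 (Suc n) k"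
      "A \<in> partial_perms1 (Suc n) k \<Longrightarrow> A \<notin> partial_perms4 (Suc n) k"
      "A \<in> partial_perms2 (Suc n) k \<union> partial_perms3 (Suc n) k \<Longrightarrow> A \<notin> partial_perms4 (Suc n) k"
proof -
  have pp: "partial_permutation (Suc n) A"
    and k: "card {i. i < Suc n \<and> row A i = 0\<^sub>v (Suc n)} = k"
    using assms by (auto simp: partial_perms_def)
  note count = card_zero_rows_delete_last[OF pp, unfolded k]
  note c = partial_permutation_carrier[OF pp]
    and bin = partial_permutation_entry[OF pp, of n n, simplified]
  have lr: "A $$ (n, n) = 0" if "last_row_zero (Suc n) A"
    using that row_eq_zero_iff[OF c, of n] by (simp add: last_row_zero_def)
  have lc: "A $$ (n, n) = 0" if "last_col_zero (Suc n) A"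
    using that col_eq_zero_iff[OF c, of n] by (simp add: last_col_zero_def)
  note defs = partial_perms1_def partial_perms2_def partial_perms3_def partial_perms4_def
  show "1 \<le> k \<and> delete_last (Suc n) A \<in> partial_perms n (k - 1)" if "A \<in> partial_perms1 (Suc n) k"
    using that count partial_permutation_delete_last[OF pp]
    by (auto simp: defs partial_perms_def[of n])
  show "delete_last (Suc n) A \<in> partial_perms n k"
    if "A \<in> partial_perms2 (Suc n) k \<union> partial_perms3 (Suc n) k"
    using that count partial_permutation_delete_last[OF pp] lr lc
    by (auto simp: defs partial_perms_def[of n] split: if_splits)
  show "delete_last (Suc n) A \<in> partial_perms n (k + 1)" if "A \<in> partial_perms4 (Suc n) k"
    using that count partial_permutation_delete_last[OF pp]
    by (auto simp: defs partial_perms_def[of n])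
  show "A \<in> partial_perms1 (Suc n) k \<or> A \<in> partial_perms2 (Suc n) k \<union> partial_perms3 (Suc n) k
         \<or> A \<in> partial_perms4 (Suc n) k"
    using assms bin by (auto simp: defs)
  show "A \<in> partial_perms1 (Suc n) k \<Longrightarrow> A \<notin> partial_perms2 (Suc n) k \<union> partial_perms3 (Suc n) k"
    "A \<in> partial_perms1 (Suc n) k \<Longrightarrow> A \<notin> partial_perms4 (Suc n) k"
    "A \<in> partial_perms2 (Suc n) k \<union> partial_perms3 (Suc n) k \<Longrightarrow> A \<notin> partial_perms4 (Suc n) k"
    using lr by (auto simp: defs)
qed

section \<open>Connectedness under deletion, and sums over the connected matrices of a class\<close>

text \<open>Deletion does not change the leading blocks of size at most \<open>n\<close>. Those of
  size below \<open>n\<close> decide whether the smaller matrix is connected, and the block of size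
  \<open>n\<close> is that matrix itself. For \<open>n = 0\<close> this fails: the empty matrix is a
  permutation matrix, but block size 0 is not tested.\<close>

lemma connected_pp_Suc_iff:
  assumes A: "A \<in> carrier_mat (Suc n) (Suc n)" and n: "1 \<le> n"
  shows "connected_pp (Suc n) A \<longleftrightarrow>
    connected_pp n (delete_last (Suc n) A) \<and> \<not> permutation_matrix n (delete_last (Suc n) A)"
proof -
  let ?D = "delete_last (Suc n) A"
  have D: "?D \<in> carrier_mat n n"
    by (simp add: delete_last_eq[OF A])
  have "submatrix A {..<i} {..<i} = submatrix ?D {..<i} {..<i}" if "i \<le> n" for i
    unfolding submatrix_lessThan[OF D that that]
    using that by (subst submatrix_lessThan[OF A]) (auto simp: delete_last_eq[OF A])
  then have below: "permutation_matrix i (submatrix A {..<i} {..<i})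
      \<longleftrightarrow> permutation_matrix i (submatrix ?D {..<i} {..<i})" if "i < n" for i
    using that by simp
  have "submatrix A {..<n} {..<n} = ?D"
    by (simp add: submatrix_lessThan[OF A] delete_last_eq[OF A])
  then show ?thesis
    unfolding connected_pp_def using n by (auto simp: less_Suc_eq below)
qed

text \<open>Only \<open>j \<ge> 1\<close> contributes: a matrix with no zero row is a permutation matrix, and no
  connected matrix restricts to it.\<close>
lemma sum_connected_fibres:
  fixes w :: "nat mat \<Rightarrow> 'a::comm_ring_1"
  assumes n: "1 \<le> n" and X: "X \<subseteq> partial_perms (Suc n) k"
    and del: "\<And>A. A \<in> X \<Longrightarrow> delete_last (Suc n) A \<in> partial_perms n j"
    and fibre: "\<And>B. B \<in> partial_perms n j \<Longrightarrow> (\<Sum>A | A \<in> X \<and> delete_last (Suc n) A = B. w A) = c * w B"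
  shows "(\<Sum>A | A \<in> X \<and> connected_pp (Suc n) A. w A)
       = (if j = 0 then 0 else c * (\<Sum>B\<in>connected_partial_perms n j. w B))"
proof -
  let ?R = "connected_partial_perms n j"
  let ?S = "{A \<in> X. connected_pp (Suc n) A}"
  have perm: "permutation_matrix n B \<longleftrightarrow> j = 0" if "B \<in> partial_perms n j" for B
    using that by (auto simp: permutation_matrix_iff partial_perms_def)
  \<comment> \<open>Within \<open>X\<close>, connectedness depends only on the matrix left after
    deletion, so each fibre is either wholly connected or wholly disconnected.\<close>
  have conn: "connected_pp (Suc n) A \<longleftrightarrow> delete_last (Suc n) A \<in> ?R \<and> j \<noteq> 0" if "A \<in> X" for A
  proof -
    have "A \<in> carrier_mat (Suc n) (Suc n)"
      using that X by (auto simp: partial_perms_def partial_permutation_def)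
    then show ?thesis
      using connected_pp_Suc_iff[OF _ n] del[OF that] perm by (auto simp: connected_partial_perms_def)
  qed
  show ?thesis
  proof (cases "j = 0")
    case True
    then have "?S = {}" using conn by blast
    with True show ?thesis by (simp only: sum.empty if_True refl)
  next
    case False
    have "finite ?S"
      using X by (rule_tac finite_subset[OF _ finite_partial_perms]) auto
    moreover have "finite ?R"
      by (rule finite_subset[OF _ finite_partial_perms]) (auto simp: connected_partial_perms_def)
    ultimately have "(\<Sum>A\<in>?S. w A) = (\<Sum>B\<in>?R. \<Sum>A | A \<in> ?S \<and> delete_last (Suc n) A = B. w A)"
      by (intro sum.group[symmetric]) (auto simp: conn)
    also have "\<dots> = (\<Sum>B\<in>?R. c * w B)"
    proof (rule sum.cong[OF refl])
      fix B assume B: "B \<in> ?R"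
      \<comment> \<open>Over a connected \<open>B\<close> with \<open>j \<noteq> 0\<close> the
        restriction to connected matrices removes nothing, so the hypothesis on full fibres
        applies.\<close>
      then have "{A. A \<in> ?S \<and> delete_last (Suc n) A = B} = {A. A \<in> X \<and> delete_last (Suc n) A = B}"
        using False conn by auto
      with B show "(\<Sum>A | A \<in> ?S \<and> delete_last (Suc n) A = B. w A) = c * w B"
        using fibre by (simp add: connected_partial_perms_def)
    qed
    finally show ?thesis
      using False by (simp add: sum_distrib_left)
  qed
qed

section \<open>The recurrence for the connected generating functions and the two identities\<close>

theorem theorem6p3:
  fixes s t z :: "nat \<Rightarrow> 'a::comm_ring_1"
    and r :: nat
    and stat :: "nat \<Rightarrow> nat mat \<Rightarrow> nat"
  assumes t_nonzero: "\<And>i. i \<ge> 1 \<Longrightarrow> t i \<noteq> 0"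
    and entries: "\<And>n k. catalan_matrix s t n k = (\<Sum>\<pi>\<in>partial_perms n k. stat_weight r z stat \<pi>)"
    and cond1: "\<And>n k \<rho>. n \<ge> 1 \<Longrightarrow> k \<ge> 1 \<Longrightarrow> \<rho> \<in> partial_perms (n - 1) (k - 1) \<Longrightarrow>
      (\<Sum>\<pi> | \<pi> \<in> partial_perms1 n k \<and> delete_last n \<pi> = \<rho>. stat_weight r z stat \<pi>)
        = stat_weight r z stat \<rho>"
    and cond2: "\<And>n k \<rho>. n \<ge> 1 \<Longrightarrow> \<rho> \<in> partial_perms (n - 1) k \<Longrightarrow>
      (\<Sum>\<pi> | \<pi> \<in> partial_perms2 n k \<union> partial_perms3 n k \<and> delete_last n \<pi> = \<rho>. stat_weight r z stat \<pi>)
        = s k * stat_weight r z stat \<rho>"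
    and cond3: "\<And>n k \<rho>. n \<ge> 1 \<Longrightarrow> \<rho> \<in> partial_perms (n - 1) (k + 1) \<Longrightarrow>
      (\<Sum>\<pi> | \<pi> \<in> partial_perms4 n k \<and> delete_last n \<pi> = \<rho>. stat_weight r z stat \<pi>)
        = t (k + 1) * stat_weight r z stat \<rho>"
  shows "(\<forall>n k. catalan_matrix (\<lambda>l. s (l + 1)) (\<lambda>l. t (l + 1)) n k
                  = connected_gf r z stat (n + 1) (k + 1)) \<and>
         (\<forall>n\<ge>2. connected_gf r z stat n 0 = t 1 * connected_gf r z stat (n - 1) 1)"
proof -
  let ?w = "stat_weight r z stat"
  let ?C = "connected_gf r z stat"
  \<comment> \<open>The three terms come from smaller matrices with \<open>k - 1\<close>,
    \<open>k\<close> and \<open>k + 1\<close> zero rows. A term vanishes when that number is 0; this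
    never happens to the third.\<close>
  have rec: "?C (Suc n) k = (if k \<le> 1 then 0 else ?C n (k - 1))
      + (if k = 0 then 0 else s k * ?C n k) + t (k + 1) * ?C n (k + 1)" if n: "1 \<le> n" for n k
  proof -
    let ?P1 = "partial_perms1 (Suc n) k"
    let ?P23 = "partial_perms2 (Suc n) k \<union> partial_perms3 (Suc n) k"
    let ?P4 = "partial_perms4 (Suc n) k"
    let ?conn = "\<lambda>X. {A. A \<in> X \<and> connected_pp (Suc n) A}"
    have sub: "?P1 \<subseteq> partial_perms (Suc n) k" "?P23 \<subseteq> partial_perms (Suc n) k"
      "?P4 \<subseteq> partial_perms (Suc n) k"
      by (auto simp: partial_perms1_def partial_perms2_def partial_perms3_def partial_perms4_def)
    have fin: "finite (?conn X)" if "X \<subseteq> partial_perms (Suc n) k" for X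
      using that by (rule_tac finite_subset[OF _ finite_partial_perms]) auto
    have P1: "(\<Sum>A\<in>?conn ?P1. ?w A) = (if k \<le> 1 then 0 else ?C n (k - 1))"
    \<comment> \<open>At \<open>k = 0\<close> the truncated \<open>k - 1\<close> would not be the
      intended index -1; there the class is empty, since its zero last row is counted.\<close>
    proof (cases "k = 0")
      case True
      then have "?P1 = {}"
        using sub(1) delete_last_partial_perms1 by fastforce
      with True show ?thesis by simp
    next
      case False
      have "(\<Sum>A\<in>?conn ?P1. ?w A)
          = (if k - 1 = 0 then 0 else 1 * (\<Sum>B\<in>connected_partial_perms n (k - 1). ?w B))"
        using n sub(1)
      proof (rule sum_connected_fibres)
        show "delete_last (Suc n) A \<in> partial_perms n (k - 1)" if "A \<in> ?P1" for A
          using that sub(1) delete_last_partial_perms1 by blast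
        show "(\<Sum>A | A \<in> ?P1 \<and> delete_last (Suc n) A = B. ?w A) = 1 * ?w B"
          if "B \<in> partial_perms n (k - 1)" for B
          using cond1[of "Suc n" k B] False that by simp
      qed
      then show ?thesis by (simp add: connected_gf_def)
    qed
    have P23: "(\<Sum>A\<in>?conn ?P23. ?w A) = (if k = 0 then 0 else s k * ?C n k)"
      unfolding connected_gf_def using n sub(2)
    proof (rule sum_connected_fibres)
      show "delete_last (Suc n) A \<in> partial_perms n k" if "A \<in> ?P23" for A
        using that sub(2) delete_last_partial_perms23 by blast
      show "(\<Sum>A | A \<in> ?P23 \<and> delete_last (Suc n) A = B. ?w A) = s k * ?w B"
        if "B \<in> partial_perms n k" for B
        using cond2[of "Suc n" B k] that by simp
    qed
    have "(\<Sum>A\<in>?conn ?P4. ?w A)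
        = (if k + 1 = 0 then 0 else t (k + 1) * (\<Sum>B\<in>connected_partial_perms n (k + 1). ?w B))"
      using n sub(3)
    proof (rule sum_connected_fibres)
      show "delete_last (Suc n) A \<in> partial_perms n (k + 1)" if "A \<in> ?P4" for A
        using that sub(3) delete_last_partial_perms4 by blast
      show "(\<Sum>A | A \<in> ?P4 \<and> delete_last (Suc n) A = B. ?w A) = t (k + 1) * ?w B"
        if "B \<in> partial_perms n (k + 1)" for B
        using cond3[of "Suc n" B k] that by simp
    qed
    then have P4: "(\<Sum>A\<in>?conn ?P4. ?w A) = t (k + 1) * ?C n (k + 1)"
      by (simp add: connected_gf_def)
    have "connected_partial_perms (Suc n) k = ?conn ?P1 \<union> ?conn ?P23 \<union> ?conn ?P4"
      using partial_perms_cases[of _ n k] sub unfolding connected_partial_perms_def by blast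
    moreover have "?conn ?P1 \<inter> ?conn ?P23 = {}"
      using partial_perms_disjoint(1)[of _ n k] sub(1) by blast
    moreover have "(?conn ?P1 \<union> ?conn ?P23) \<inter> ?conn ?P4 = {}"
      using partial_perms_disjoint(2,3)[of _ n k] sub(1,2) by blast
    ultimately have "?C (Suc n) k
        = (\<Sum>A\<in>?conn ?P1. ?w A) + (\<Sum>A\<in>?conn ?P23. ?w A) + (\<Sum>A\<in>?conn ?P4. ?w A)"
      unfolding connected_gf_def
      by (simp only: sum.union_disjoint[OF finite_UnI[OF fin fin] fin]
          sum.union_disjoint[OF fin fin] sub)
    then show ?thesis
      using P1 P23 P4 by (simp only:)
  qed
  \<comment> \<open>In order 1 there is no proper leading block to test, so every partial
    permutation is connected and \<open>entries\<close> gives the value from row 1 of the original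
    matrix. Beyond column 0 that row only receives the shifted initial row.\<close>
  have base: "?C 1 (k + 1) = (if k = 0 then 1 else 0)" for k
  proof -
    have conn1: "connected_partial_perms 1 j = partial_perms 1 j" for j
      by (auto simp: connected_partial_perms_def connected_pp_def)
    have "?C 1 (k + 1) = catalan_matrix s t 1 (k + 1)"
      by (simp only: connected_gf_def conn1 entries)
    then show ?thesis by simp
  qed
  have "catalan_matrix (\<lambda>l. s (l + 1)) (\<lambda>l. t (l + 1)) n k = ?C (n + 1) (k + 1)" for n k
  proof (induction n arbitrary: k)
    case 0
    show ?case using base[of k] by simp
  next
    case (Suc n)
    \<comment> \<open>The term dropped from \<open>rec\<close> at \<open>k + 1 = 1\<close> is the
      one that a Catalan matrix lacks to the left of column 0, and the coefficients
      \<open>s (k + 1)\<close> and \<open>t (k + 2)\<close> are the shifted seeds at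
      \<open>k\<close> and \<open>k + 1\<close>.\<close>
    show ?case
      using rec[of "n + 1" "k + 1"] by (auto simp: Suc[simplified])
  qed
  \<comment> \<open>At \<open>k = 0\<close> only the term from the fourth class survives;
    \<open>n \<ge> 2\<close> supplies the condition \<open>1 \<le> n - 1\<close> of
    \<open>rec\<close>.\<close>
  moreover have "?C n 0 = t 1 * ?C (n - 1) 1" if "n \<ge> 2" for n
    using rec[of "n - 1" 0] that by simp
  ultimately show ?thesis by blast
qed

end
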